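(* Consider the many-to-one matching game with externalities between D2D pairs $\mathcal{D}$ and channels $\mathcal{K}$, with utilities $U_d$ ($d\in\mathcal{D}$) and $U_k$ ($k\in\mathcal{K}$) and quotas $n_k=D$, as defined in the context. Then the channel allocation algorithm described in the context (Gale--Shapley-based initialization followed by repeated approved swap operations) always converges to a strongly swap-stable matching; that is, for every sequence of choices of approved swaps, it terminates after finitely many swap operations, and the matching obtained upon termination is strongly swap-stable.
   Context: Data. $\mathcal{D}=\{1,\dots,D\}$ is a finite nonempty set of D2D pairs and $\mathcal{K}$ is a finite nonempty set of $K$ channels. The constants $P_m$ (transmit power of every D2D transmitter), $q_c$ (transmit power of cellular users), $n_0$ (noise power), $w$, $\theta$, $\xi_1$, $\xi_2$, $Q_k$ ($k\in\mathcal{K}$), and the channel gains $g^k_{ij}$ (from D2D transmitter $i$ to D2D receiver $j$ on channel $k$), $g^k_d$ (from the cellular user of channel $k$ to D2D receiver $d$), $h^k_d$ (from D2D transmitter $d$ to the cellular link on channel $k$), for $i,j,d\in\mathcal{D}$, $k\in\mathcal{K}$, are positive real numbers. Matchings. A matching $\mu\subseteq\mathcal{D}\times\mathcal{K}$ assigns to each D2D pair $d$ exactly one channel, denoted $\mu(d)$; $\mu(k)$ is the set of D2D pairs $d$ with $\mu(d)=k$. Every channel $k$ has quota $n_k=D$. If $|\mu(k)|=r<n_k$, channel $k$ is regarded as also being matched to $n_k-r$ "holes"; a hole is a fictitious D2D pair with no preferences over matchings, which contributes nothing to any utility and is not counted in $|\mu(k)|$. Write $\mu^2(d)=\mu(\mu(d))$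 for the set of D2D pairs using the same channel as $d$. Utilities. For $d\in\mathcal{D}$, $U_d(\mu)=\xi_1\phi_d(\mu)-\theta$ with $$\phi_d(\mu)=\ln\Big(\frac{P_m g^{\mu(d)}_{dd}}{n_0}\Big)-w q_c g^{\mu(d)}_d-\sum_{i\in\mu^2(d),\,i\neq d}\frac{w}{2}P_m\big(g^{\mu(d)}_{di}+g^{\mu(d)}_{id}\big)$$ (a D2D pair not matched with any channel would have utility $-\infty$). For $k\in\mathcal{K}$, $$U_k(\mu)=\theta|\mu(k)|-\xi_2\max\Big(0,\sum_{d\in\mu(k)}\frac{P_m h^k_d}{Q_k}-1\Big).$$ Swap-matchings. Given a matching $\mu$, D2D pairs $s,t$ (one of which may be a hole) and channels $m,n$ with $(s,m),(t,n)\in\mu$, the swap-matching is $\mu^s_t=\mu\setminus\{(s,m),(t,n)\}\cup\{(s,n),(t,m)\}$. When $t$ is a hole of channel $n$, this means that $s$ moves from channel $m$ to channel $n$ and all else is unchanged. Approved swaps and stability. A swap-matching $\mu^s_t$ is approved (by the players involved) if $U_s(\mu^s_t)\ge U_s(\mu)$, $U_t(\mu^s_t)\ge U_t(\mu)$, and $U_{\mu(s)}(\mu^s_t)+U_{\mu(t)}(\mu^s_t)\ge U_{\mu(s)}(\mu)+U_{\mu(t)}(\mu)$, where $\mu(s),\mu(t)$ are the two channels involved, with at least one of these three inequalities strict. If $s$ or $t$ is a hole, the corresponding inequality is void (neither required nor counted as strict). A matching $\mu$ is strongly swap-stable if and only if it has no approved swap-matching $\mu^s_t$. Algorithm. Initialization: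 each D2D pair $d$ ranks channels in descending order of $\tilde\gamma^k_d=\frac{P_m g^k_{dd}}{n_0+q_c g^k_d}$, and each channel $k$ ranks D2D pairs in ascending order of $h^k_d$ (ties broken arbitrarily). Each D2D pair that is not currently accepted proposes to its most preferred channel that has not rejected it before; each channel keeps its $n_k$ most preferred proposers and rejects the others; this is repeated until every D2D pair is accepted by a channel. This gives the initial matching $\mu$. Swap phase: as long as the current matching $\mu$ has an approved swap-matching, one such $\mu^s_t$ is selected and $\mu$ is replaced by $\mu^s_t$; the algorithm terminates when no approved swap-matching exists. *)

theory Defs
  imports Complex_Main "HOL-Library.Extended_Real"
begin

text \<open>
  \<open>gain k i j\<close> is the gain from transmitter \<open>i\<close> to receiver \<open>j\<close> on channel \<open>k\<close>;
  \<open>gain_cu k d\<close> from the cellular user of channel \<open>k\<close> to receiver \<open>d\<close>;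
  \<open>gain_h k d\<close> from transmitter \<open>d\<close> to the cellular link on channel \<open>k\<close>.
\<close>

record 'k d2d_network =
  num_pairs :: nat
  channels :: "'k set"
  P\<^sub>m :: real
  q\<^sub>c :: real
  n\<^sub>0 :: real
  weight :: real
  \<theta> :: real
  \<xi>\<^sub>1 :: real
  \<xi>\<^sub>2 :: real
  Q_thr :: "'k \<Rightarrow> real"
  gain :: "'k \<Rightarrow> nat \<Rightarrow> nat \<Rightarrow> real"
  gain_cu :: "'k \<Rightarrow> nat \<Rightarrow> real"
  gain_h :: "'k \<Rightarrow> nat \<Rightarrow> real"

definition pairs :: "'k d2d_network \<Rightarrow> nat set" where
  "pairs N = {1..num_pairs N}"

definition quota :: "'k d2d_network \<Rightarrow> 'k \<Rightarrow> nat" where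
  "quota N k = num_pairs N"

definition valid_network :: "'k d2d_network \<Rightarrow> bool" where
  "valid_network N \<longleftrightarrow>
     num_pairs N \<ge> 1 \<and> finite (channels N) \<and> channels N \<noteq> {} \<and>
     P\<^sub>m N > 0 \<and> q\<^sub>c N > 0 \<and> n\<^sub>0 N > 0 \<and> weight N > 0 \<and> \<theta> N > 0 \<and> \<xi>\<^sub>1 N > 0 \<and> \<xi>\<^sub>2 N > 0 \<and>
     (\<forall>k\<in>channels N. Q_thr N k > 0) \<and>
     (\<forall>k\<in>channels N. \<forall>i\<in>pairs N. \<forall>j\<in>pairs N. gain N k i j > 0) \<and>
     (\<forall>k\<in>channels N. \<forall>d\<in>pairs N. gain_cu N k d > 0 \<and> gain_h N k d > 0)"

definition pairs_on :: "(nat \<times> 'k) set \<Rightarrow> 'k \<Rightarrow> nat set" where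
  "pairs_on \<mu> k = {d. (d, k) \<in> \<mu>}"

definition is_matching :: "'k d2d_network \<Rightarrow> (nat \<times> 'k) set \<Rightarrow> bool" where
  "is_matching N \<mu> \<longleftrightarrow>
     \<mu> \<subseteq> pairs N \<times> channels N \<and>
     (\<forall>d\<in>pairs N. \<exists>!k. (d, k) \<in> \<mu>) \<and>
     (\<forall>k\<in>channels N. card (pairs_on \<mu> k) \<le> quota N k)"

definition channel_of :: "(nat \<times> 'k) set \<Rightarrow> nat \<Rightarrow> 'k" where
  "channel_of \<mu> d = (THE k. (d, k) \<in> \<mu>)"

definition \<phi> :: "'k d2d_network \<Rightarrow> nat \<Rightarrow> (nat \<times> 'k) set \<Rightarrow> real" where
  "\<phi> N d \<mu> =
     (let k = channel_of \<mu> d in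
        ln (P\<^sub>m N * gain N k d d / n\<^sub>0 N) - weight N * q\<^sub>c N * gain_cu N k d
        - (\<Sum>i\<in>pairs_on \<mu> k - {d}. weight N / 2 * P\<^sub>m N * (gain N k d i + gain N k i d)))"

definition U_pair :: "'k d2d_network \<Rightarrow> nat \<Rightarrow> (nat \<times> 'k) set \<Rightarrow> ereal" where
  "U_pair N d \<mu> = (if d \<in> Domain \<mu> then ereal (\<xi>\<^sub>1 N * \<phi> N d \<mu> - \<theta> N) else - \<infinity>)"

definition U_channel :: "'k d2d_network \<Rightarrow> 'k \<Rightarrow> (nat \<times> 'k) set \<Rightarrow> real" where
  "U_channel N k \<mu> =
     \<theta> N * real (card (pairs_on \<mu> k))
     - \<xi>\<^sub>2 N * max 0 ((\<Sum>d\<in>pairs_on \<mu> k. P\<^sub>m N * gain_h N k d / Q_thr N k) - 1)"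

text \<open>
  The holes of a channel are interchangeable, so a single value \<open>Hole\<close> represents them all;
  which channel the hole belongs to is always given alongside.
\<close>

datatype player = Pair nat | Hole

fun matched_with :: "'k d2d_network \<Rightarrow> (nat \<times> 'k) set \<Rightarrow> player \<Rightarrow> 'k \<Rightarrow> bool" where
  "matched_with N \<mu> (Pair d) k \<longleftrightarrow> (d, k) \<in> \<mu>"
| "matched_with N \<mu> Hole k \<longleftrightarrow> k \<in> channels N \<and> card (pairs_on \<mu> k) < quota N k"

fun assignment :: "player \<Rightarrow> 'k \<Rightarrow> (nat \<times> 'k) set" where
  "assignment (Pair d) k = {(d, k)}"
| "assignment Hole k = {}"

definition swap :: "(nat \<times> 'k) set \<Rightarrow> player \<Rightarrow> 'k \<Rightarrow> player \<Rightarrow> 'k \<Rightarrow> (nat \<times> 'k) set" where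
  "swap \<mu> s m t n = (\<mu> - (assignment s m \<union> assignment t n)) \<union> (assignment s n \<union> assignment t m)"

fun not_worse :: "'k d2d_network \<Rightarrow> player \<Rightarrow> (nat \<times> 'k) set \<Rightarrow> (nat \<times> 'k) set \<Rightarrow> bool" where
  "not_worse N (Pair d) \<mu> \<mu>' \<longleftrightarrow> U_pair N d \<mu>' \<ge> U_pair N d \<mu>"
| "not_worse N Hole \<mu> \<mu>' \<longleftrightarrow> True"

fun strictly_better :: "'k d2d_network \<Rightarrow> player \<Rightarrow> (nat \<times> 'k) set \<Rightarrow> (nat \<times> 'k) set \<Rightarrow> bool" where
  "strictly_better N (Pair d) \<mu> \<mu>' \<longleftrightarrow> U_pair N d \<mu>' > U_pair N d \<mu>"
| "strictly_better N Hole \<mu> \<mu>' \<longleftrightarrow> False"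

definition approved_swap :: "'k d2d_network \<Rightarrow> (nat \<times> 'k) set \<Rightarrow> (nat \<times> 'k) set \<Rightarrow> bool" where
  "approved_swap N \<mu> \<mu>' \<longleftrightarrow>
     (\<exists>s m t n.
        (s \<noteq> Hole \<or> t \<noteq> Hole) \<and> matched_with N \<mu> s m \<and> matched_with N \<mu> t n \<and>
        \<mu>' = swap \<mu> s m t n \<and>
        not_worse N s \<mu> \<mu>' \<and> not_worse N t \<mu> \<mu>' \<and>
        U_channel N m \<mu>' + U_channel N n \<mu>' \<ge> U_channel N m \<mu> + U_channel N n \<mu> \<and>
        (strictly_better N s \<mu> \<mu>' \<or> strictly_better N t \<mu> \<mu>' \<or>
         U_channel N m \<mu>' + U_channel N n \<mu>' > U_channel N m \<mu> + U_channel N n \<mu>))"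

definition strongly_swap_stable :: "'k d2d_network \<Rightarrow> (nat \<times> 'k) set \<Rightarrow> bool" where
  "strongly_swap_stable N \<mu> \<longleftrightarrow> is_matching N \<mu> \<and> \<not> (\<exists>\<mu>'. approved_swap N \<mu> \<mu>')"

definition \<gamma> :: "'k d2d_network \<Rightarrow> nat \<Rightarrow> 'k \<Rightarrow> real" where
  "\<gamma> N d k = P\<^sub>m N * gain N k d d / (n\<^sub>0 N + q\<^sub>c N * gain_cu N k d)"

text \<open>
  Rankings are lists with the most preferred item first.  Any lists satisfying the following
  predicates are allowed, which leaves the breaking of ties arbitrary.
\<close>

definition pair_rankings :: "'k d2d_network \<Rightarrow> (nat \<Rightarrow> 'k list) \<Rightarrow> bool" where
  "pair_rankings N R \<longleftrightarrow>
     (\<forall>d\<in>pairs N. distinct (R d) \<and> set (R d) = channels N \<and>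
                  sorted_wrt (\<lambda>k k'. \<gamma> N d k \<ge> \<gamma> N d k') (R d))"

definition channel_rankings :: "'k d2d_network \<Rightarrow> ('k \<Rightarrow> nat list) \<Rightarrow> bool" where
  "channel_rankings N S \<longleftrightarrow>
     (\<forall>k\<in>channels N. distinct (S k) \<and> set (S k) = pairs N \<and>
                     sorted_wrt (\<lambda>d d'. gain_h N k d \<le> gain_h N k d') (S k))"

text \<open>
  In a round of deferred acceptance, \<open>A\<close> is the set of current (tentative) acceptances and \<open>B\<close> the
  set of pairs \<open>(d, k)\<close> such that \<open>k\<close> has rejected \<open>d\<close> so far.  The candidates of a channel are
  its currently accepted pairs together with its new proposers.
\<close>

definition proposals ::
  "'k d2d_network \<Rightarrow> (nat \<Rightarrow> 'k list) \<Rightarrow> (nat \<times> 'k) set \<Rightarrow> (nat \<times> 'k) set \<Rightarrow> (nat \<times> 'k) set" where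
  "proposals N R A B =
     {(d, k). d \<in> pairs N \<and> d \<notin> Domain A \<and> (\<exists>ks. filter (\<lambda>c. (d, c) \<notin> B) (R d) = k # ks)}"

definition keep ::
  "'k d2d_network \<Rightarrow> ('k \<Rightarrow> nat list) \<Rightarrow> (nat \<times> 'k) set \<Rightarrow> (nat \<times> 'k) set" where
  "keep N S C =
     {(d, k). k \<in> channels N \<and> d \<in> set (take (quota N k) (filter (\<lambda>e. (e, k) \<in> C) (S k)))}"

datatype 'k config =
    Proposing "(nat \<times> 'k) set" "(nat \<times> 'k) set"
  | Swapping "(nat \<times> 'k) set"

inductive alg_step ::
  "'k d2d_network \<Rightarrow> (nat \<Rightarrow> 'k list) \<Rightarrow> ('k \<Rightarrow> nat list) \<Rightarrow> 'k config \<Rightarrow> 'k config \<Rightarrow> bool"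
  for N R S where
  propose:
    "\<lbrakk> \<not> pairs N \<subseteq> Domain A; C = A \<union> proposals N R A B \<rbrakk> \<Longrightarrow>
     alg_step N R S (Proposing A B) (Proposing (keep N S C) (B \<union> (C - keep N S C)))"
| initialized:
    "pairs N \<subseteq> Domain A \<Longrightarrow> alg_step N R S (Proposing A B) (Swapping A)"
| swap:
    "approved_swap N \<mu> \<mu>' \<Longrightarrow> alg_step N R S (Swapping \<mu>) (Swapping \<mu>')"

end

theory Submission
  imports Defs
begin

text \<open>
  The interference between two pairs on a common channel enters both of their utilities with the
  same symmetric weight.  Hence the sum of all standalone rates minus the interference of every
  unordered pair of users is an exact potential: a swap between distinct channels changes it by the
  sum of the changes of the \<open>\<phi>\<close> values of the (one or two) moving pairs, because these two never
  interfere with each other, neither before nor after the swap.  Adding the utilities of all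
  channels gives a quantity that every approved swap strictly increases, and there are only
  finitely many matchings.  Since every quota equals the number of pairs, the initialization
  accepts all first proposals and is over after one round.
\<close>

section \<open>An abstract exact potential for symmetric interference\<close>

definition payoff ::
  "nat set \<Rightarrow> (nat \<Rightarrow> 'k \<Rightarrow> real) \<Rightarrow> ('k \<Rightarrow> nat \<Rightarrow> nat \<Rightarrow> real) \<Rightarrow> (nat \<Rightarrow> 'k) \<Rightarrow> nat \<Rightarrow> real" where
  "payoff D b W f d = b d (f d) - (\<Sum>i\<in>D - {d}. if f i = f d then W (f d) d i else 0)"

text \<open>The double sum runs over ordered pairs of users, so for symmetric \<open>W\<close> the
  division by 2 counts each unordered pair once. The player set \<open>D\<close> is a parameter so
  that players can be deleted one at a time.\<close>

definition potential ::
  "nat set \<Rightarrow> (nat \<Rightarrow> 'k \<Rightarrow> real) \<Rightarrow> ('k \<Rightarrow> nat \<Rightarrow> nat \<Rightarrow> real) \<Rightarrow> (nat \<Rightarrow> 'k) \<Rightarrow> real" where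
  "potential D b W f =
     (\<Sum>d\<in>D. b d (f d)) - (\<Sum>d\<in>D. \<Sum>i\<in>D - {d}. if f i = f d then W (f d) d i else 0) / 2"

lemma potential_cong:
  assumes "\<And>d. d \<in> D \<Longrightarrow> f d = g d"
  shows "potential D b W f = potential D b W g"
  proof -
  have "(\<Sum>i\<in>D - {d}. if f i = f d then W (f d) d i else 0)
      = (\<Sum>i\<in>D - {d}. if g i = g d then W (g d) d i else 0)" if "d \<in> D" for d
    by (rule sum.cong) (use assms that in auto)
  then show ?thesis
    unfolding potential_def using assms by simp
qed

text \<open>Each interference term of \<open>a\<close> with another player occurs twice in the
  double sum, once from either side. By symmetry the two are equal, and halving leaves exactly the
  one copy that \<open>payoff\<close> subtracts.\<close>

lemma potential_remove:
  assumes D: "finite D" "a \<in> D" and sym: "\<And>k i j. W k i j = W k j i"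
  shows "potential D b W f = payoff D b W f a + potential (D - {a}) b W f"
proof -
  define X where "X d i = (if f i = f d then W (f d) d i else 0)" for d i
  have X_sym: "X d a = X a d" for d
    by (simp add: X_def sym[of "f a" a d])
  have inner: "(\<Sum>i\<in>D - {d}. X d i) = X a d + (\<Sum>i\<in>D - {a} - {d}. X d i)" if "d \<in> D - {a}" for d
  proof -
    have "(\<Sum>i\<in>D - {d}. X d i) = X d a + (\<Sum>i\<in>D - {d} - {a}. X d i)"
      using D that by (intro sum.remove) auto
    moreover have "D - {d} - {a} = D - {a} - {d}"
      by blast
    ultimately show ?thesis
      by (simp add: X_sym)
  qed
  have "(\<Sum>d\<in>D. \<Sum>i\<in>D - {d}. X d i)
      = (\<Sum>i\<in>D - {a}. X a i) + (\<Sum>d\<in>D - {a}. \<Sum>i\<in>D - {d}. X d i)"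
    using D by (simp add: sum.remove)
  also have "(\<Sum>d\<in>D - {a}. \<Sum>i\<in>D - {d}. X d i)
      = (\<Sum>d\<in>D - {a}. X a d) + (\<Sum>d\<in>D - {a}. \<Sum>i\<in>D - {a} - {d}. X d i)"
    by (simp add: inner sum.distrib)
  finally have "(\<Sum>d\<in>D. \<Sum>i\<in>D - {d}. X d i)
      = 2 * (\<Sum>i\<in>D - {a}. X a i) + (\<Sum>d\<in>D - {a}. \<Sum>i\<in>D - {a} - {d}. X d i)"
    by simp
  moreover have "(\<Sum>d\<in>D. b d (f d)) = b a (f a) + (\<Sum>d\<in>D - {a}. b d (f d))"
    using D by (rule sum.remove)
  ultimately show ?thesis
    unfolding potential_def payoff_def X_def[symmetric] by (simp add: field_simps)
qed

text \<open>With \<open>a\<close> deleted, the remaining potential does not see the value of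
  \<open>f\<close> at \<open>a\<close>, so only the payoff of \<open>a\<close> can change.\<close>

lemma potential_move:
  assumes D: "finite D" "a \<in> D" and sym: "\<And>k i j. W k i j = W k j i"
  shows "potential D b W (f(a := n)) - potential D b W f
       = payoff D b W (f(a := n)) a - payoff D b W f a"
proof -
  have "potential (D - {a}) b W (f(a := n)) = potential (D - {a}) b W f"
    by (rule potential_cong) simp
  then show ?thesis
    using potential_remove[of D a W b f] potential_remove[of D a W b "f(a := n)"] assms by simp
qed

text \<open>Players on different channels do not interfere, so deleting \<open>a\<close> leaves the
  payoff of \<open>c\<close> intact. Both can thus be split off at full payoff, before and after the
  exchange, and the remainder does not change.\<close>

lemma potential_exchange:
  assumes D: "finite D" "a \<in> D" "c \<in> D" and sym: "\<And>k i j. W k i j = W k j i"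
    and diff: "f a \<noteq> f c"
  defines "f' \<equiv> f(a := f c, c := f a)"
  shows "potential D b W f' - potential D b W f
       = (payoff D b W f' a - payoff D b W f a) + (payoff D b W f' c - payoff D b W f c)"
proof -
  have ac: "a \<noteq> c"
    using diff by auto
  \<comment> \<open>Stated for any \<open>h\<close> that separates \<open>a\<close> and
    \<open>c\<close>, since it is applied both to \<open>f\<close> and to \<open>f'\<close>.\<close>
  have split: "potential D b W h
      = payoff D b W h a + payoff D b W h c + potential (D - {a} - {c}) b W h"
    if "h a \<noteq> h c" for h
  proof -
    have "(\<Sum>i\<in>D - {c}. if h i = h c then W (h c) c i else 0)
        = (\<Sum>i\<in>D - {a} - {c}. if h i = h c then W (h c) c i else 0)"
      using D that by (intro sum.mono_neutral_right) auto
    then have "payoff (D - {a}) b W h c = payoff D b W h c"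
      by (simp add: payoff_def)
    then show ?thesis
      using potential_remove[of D a W b h] potential_remove[of "D - {a}" c W b h] D ac sym that
      by simp
  qed
  have "potential (D - {a} - {c}) b W f' = potential (D - {a} - {c}) b W f"
    by (rule potential_cong) (simp add: f'_def)
  moreover have "f' a \<noteq> f' c"
    using diff ac by (simp add: f'_def)
  ultimately show ?thesis
    using split[of f] split[of f'] diff by simp
qed

section \<open>Matchings as functions from pairs to channels\<close>

definition allocation :: "'k d2d_network \<Rightarrow> (nat \<Rightarrow> 'k) \<Rightarrow> (nat \<times> 'k) set" where
  "allocation N f = (\<lambda>d. (d, f d)) ` pairs N"

lemma finite_pairs [simp]: "finite (pairs N)"
  by (simp add: pairs_def)

lemma mem_allocation [simp]: "(d, k) \<in> allocation N f \<longleftrightarrow> d \<in> pairs N \<and> k = f d"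
  by (auto simp: allocation_def)

lemma Domain_allocation [simp]: "Domain (allocation N f) = pairs N"
  by (auto simp: Domain_iff)

lemma channel_of_allocation: "d \<in> pairs N \<Longrightarrow> channel_of (allocation N f) d = f d"
  by (simp add: channel_of_def)

lemma pairs_on_allocation: "pairs_on (allocation N f) k = {d \<in> pairs N. f d = k}"
  by (auto simp: pairs_on_def)

lemma is_matching_allocation:
  assumes "f ` pairs N \<subseteq> channels N"
  shows "is_matching N (allocation N f)"
proof -
  have "card (pairs_on (allocation N f) k) \<le> quota N k" for k
  proof -
    have "card (pairs_on (allocation N f) k) \<le> card (pairs N)"
      by (rule card_mono) (auto simp: pairs_on_allocation)
    then show ?thesis
      by (simp add: quota_def pairs_def)
  qed
  then show ?thesis
    using assms unfolding is_matching_def by auto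
qed

text \<open>This representation turns swaps into function updates, the form in which the potential
  lemmas apply. Values of \<open>f\<close> outside \<open>pairs N\<close> are irrelevant.\<close>

lemma is_matchingE:
  assumes "is_matching N \<mu>"
  obtains f where "\<mu> = allocation N f" "f ` pairs N \<subseteq> channels N"
proof
  have ex1: "\<exists>!k. (d, k) \<in> \<mu>" if "d \<in> pairs N" for d
    using assms that by (simp add: is_matching_def)
  have sub: "\<mu> \<subseteq> pairs N \<times> channels N"
    using assms by (simp add: is_matching_def)
  have mem: "(d, channel_of \<mu> d) \<in> \<mu>" if "d \<in> pairs N" for d
    unfolding channel_of_def using ex1[OF that] by (rule theI')
  show "\<mu> = allocation N (channel_of \<mu>)"
  proof (rule set_eqI, clarify)
    fix d k
    show "(d, k) \<in> \<mu> \<longleftrightarrow> (d, k) \<in> allocation N (channel_of \<mu>)"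
      using mem[of d] ex1[of d] sub by auto
  qed
  show "channel_of \<mu> ` pairs N \<subseteq> channels N"
    using mem sub by auto
qed

lemma swap_commute: "swap \<mu> s m t n = swap \<mu> t n s m"
  by (auto simp: swap_def)

lemma swap_allocation_Hole:
  assumes "a \<in> pairs N"
  shows "swap (allocation N f) (Pair a) (f a) Hole n = allocation N (f(a := n))"
  using assms by (auto simp: swap_def split: if_splits)

lemma swap_allocation_Pair:
  assumes "a \<in> pairs N" "c \<in> pairs N" "f a \<noteq> f c"
  shows "swap (allocation N f) (Pair a) (f a) (Pair c) (f c) = allocation N (f(a := f c, c := f a))"
  using assms by (auto simp: swap_def fun_upd_apply split: if_splits)

text \<open>\<open>approved_swap\<close> does not demand distinct channels. This covers the
  degenerate swaps, in which the removed assignments are put straight back.\<close>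

lemma swap_same_channel:
  assumes "matched_with N \<mu> s m" "matched_with N \<mu> t m"
  shows "swap \<mu> s m t m = \<mu>"
  using assms by (cases s; cases t) (auto simp: swap_def)

section \<open>The network as an instance of the abstract game, and its welfare\<close>

definition standalone_rate :: "'k d2d_network \<Rightarrow> nat \<Rightarrow> 'k \<Rightarrow> real" where
  "standalone_rate N d k =
     ln (P\<^sub>m N * gain N k d d / n\<^sub>0 N) - weight N * q\<^sub>c N * gain_cu N k d"

definition interference :: "'k d2d_network \<Rightarrow> 'k \<Rightarrow> nat \<Rightarrow> nat \<Rightarrow> real" where
  "interference N k i j = weight N / 2 * P\<^sub>m N * (gain N k i j + gain N k j i)"

lemma interference_commute: "interference N k i j = interference N k j i"
  by (simp add: interference_def add.commute)

text \<open>The channel test moves from the index set into the summand, where \<open>payoff\<close>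
  has it; the index set then no longer depends on \<open>f\<close>.\<close>

lemma \<phi>_allocation:
  assumes "d \<in> pairs N"
  shows "\<phi> N d (allocation N f) = payoff (pairs N) (standalone_rate N) (interference N) f d"
proof -
  have "(\<Sum>i\<in>pairs_on (allocation N f) (f d) - {d}. interference N (f d) d i)
      = (\<Sum>i\<in>{i \<in> pairs N - {d}. f i = f d}. interference N (f d) d i)"
    by (rule sum.cong) (auto simp: pairs_on_allocation)
  also have "\<dots> = (\<Sum>i\<in>pairs N - {d}. if f i = f d then interference N (f d) d i else 0)"
    by (rule sum.inter_filter) simp
  finally show ?thesis
    using assms
    by (simp add: \<phi>_def Let_def payoff_def channel_of_allocation standalone_rate_def
        interference_def)
qed

text \<open>The factor \<open>\<xi>\<^sub>1 N\<close> converts changes of \<phi> into changes of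
  utility; the constant \<open>\<theta> N\<close> in a pair's utility cancels in
  differences.\<close>

definition welfare :: "'k d2d_network \<Rightarrow> (nat \<times> 'k) set \<Rightarrow> real" where
  "welfare N \<mu> =
     \<xi>\<^sub>1 N * potential (pairs N) (standalone_rate N) (interference N) (channel_of \<mu>)
     + (\<Sum>k\<in>channels N. U_channel N k \<mu>)"

lemma welfare_allocation:
  "welfare N (allocation N f) =
     \<xi>\<^sub>1 N * potential (pairs N) (standalone_rate N) (interference N) f
     + (\<Sum>k\<in>channels N. U_channel N k (allocation N f))"
proof -
  have "potential (pairs N) b W (channel_of (allocation N f)) = potential (pairs N) b W f" for b W
    by (rule potential_cong) (simp add: channel_of_allocation)
  then show ?thesis
    by (simp add: welfare_def)
qed

text \<open>A channel's utility depends on the matching only through its own set of pairs, so the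
  terms of all channels other than \<open>m\<close> and \<open>n\<close> cancel.\<close>

lemma sum_U_channel_diff:
  assumes "finite (channels N)" "m \<in> channels N" "n \<in> channels N" "m \<noteq> n"
    and same: "\<And>k. k \<noteq> m \<Longrightarrow> k \<noteq> n \<Longrightarrow> pairs_on \<mu>' k = pairs_on \<mu> k"
  shows "(\<Sum>k\<in>channels N. U_channel N k \<mu>') - (\<Sum>k\<in>channels N. U_channel N k \<mu>)
       = (U_channel N m \<mu>' + U_channel N n \<mu>') - (U_channel N m \<mu> + U_channel N n \<mu>)"
proof -
  have split: "(\<Sum>k\<in>channels N. U_channel N k \<nu>)
      = U_channel N m \<nu> + (U_channel N n \<nu> + (\<Sum>k\<in>channels N - {m} - {n}. U_channel N k \<nu>))" for \<nu>
    using assms by (simp add: sum.remove[of _ m] sum.remove[of _ n])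
  have "(\<Sum>k\<in>channels N - {m} - {n}. U_channel N k \<mu>')
      = (\<Sum>k\<in>channels N - {m} - {n}. U_channel N k \<mu>)"
    by (rule sum.cong) (auto simp: U_channel_def same)
  then show ?thesis
    using split[of \<mu>] split[of \<mu>'] by simp
qed

section \<open>Approved swaps strictly increase the welfare\<close>

lemma U_pair_le_iff:
  assumes "valid_network N" "d \<in> Domain \<mu>" "d \<in> Domain \<mu>'"
  shows "U_pair N d \<mu> \<le> U_pair N d \<mu>' \<longleftrightarrow> \<phi> N d \<mu> \<le> \<phi> N d \<mu>'"
  using assms by (simp add: U_pair_def valid_network_def)

lemma U_pair_less_iff:
  assumes "valid_network N" "d \<in> Domain \<mu>" "d \<in> Domain \<mu>'"
  shows "U_pair N d \<mu> < U_pair N d \<mu>' \<longleftrightarrow> \<phi> N d \<mu> < \<phi> N d \<mu>'"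
  using assms by (simp add: U_pair_def valid_network_def)

text \<open>The welfare gain equals the utility gain of the moving pair plus the joint gain of the
  two channels. Both are nonnegative and one is positive. Pairs that stay put may lose, but the
  exact potential already accounts for them.\<close>

lemma move_to_hole_improves:
  assumes valid: "valid_network N" and f: "f ` pairs N \<subseteq> channels N"
    and a: "a \<in> pairs N" and n: "n \<in> channels N" "f a \<noteq> n"
  defines "\<mu> \<equiv> allocation N f" and "\<mu>' \<equiv> allocation N (f(a := n))"
  assumes nw: "not_worse N (Pair a) \<mu> \<mu>'"
    and ch: "U_channel N (f a) \<mu>' + U_channel N n \<mu>' \<ge> U_channel N (f a) \<mu> + U_channel N n \<mu>"
    and strict: "strictly_better N (Pair a) \<mu> \<mu>' \<or>
      U_channel N (f a) \<mu>' + U_channel N n \<mu>' > U_channel N (f a) \<mu> + U_channel N n \<mu>"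
  shows "is_matching N \<mu>' \<and> welfare N \<mu> < welfare N \<mu>'"
proof
  show "is_matching N \<mu>'"
    unfolding \<mu>'_def using f n by (intro is_matching_allocation) auto
  have "(\<Sum>k\<in>channels N. U_channel N k \<mu>') - (\<Sum>k\<in>channels N. U_channel N k \<mu>)
      = (U_channel N (f a) \<mu>' + U_channel N n \<mu>') - (U_channel N (f a) \<mu> + U_channel N n \<mu>)"
    using valid f a n
    by (intro sum_U_channel_diff) (auto simp: \<mu>_def \<mu>'_def pairs_on_allocation valid_network_def)
  moreover have "potential (pairs N) (standalone_rate N) (interference N) (f(a := n))
      - potential (pairs N) (standalone_rate N) (interference N) f = \<phi> N a \<mu>' - \<phi> N a \<mu>"
    using potential_move[where W = "interference N", OF finite_pairs a interference_commute] a
    by (simp add: \<mu>_def \<mu>'_def \<phi>_allocation)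
  ultimately have diff: "welfare N \<mu>' - welfare N \<mu> = \<xi>\<^sub>1 N * (\<phi> N a \<mu>' - \<phi> N a \<mu>)
      + ((U_channel N (f a) \<mu>' + U_channel N n \<mu>') - (U_channel N (f a) \<mu> + U_channel N n \<mu>))"
    unfolding \<mu>_def \<mu>'_def welfare_allocation by (simp add: algebra_simps flip: distrib_left)
  have xi: "\<xi>\<^sub>1 N > 0"
    using valid by (simp add: valid_network_def)
  have dom: "a \<in> Domain \<mu>" "a \<in> Domain \<mu>'"
    using a by (simp_all add: \<mu>_def \<mu>'_def)
  have "\<phi> N a \<mu> \<le> \<phi> N a \<mu>'"
    using nw U_pair_le_iff[OF valid dom] by simp
  then have "0 \<le> \<xi>\<^sub>1 N * (\<phi> N a \<mu>' - \<phi> N a \<mu>)"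
    using xi by simp
  moreover have "0 < \<xi>\<^sub>1 N * (\<phi> N a \<mu>' - \<phi> N a \<mu>)" if "strictly_better N (Pair a) \<mu> \<mu>'"
    using that xi U_pair_less_iff[OF valid dom] by simp
  ultimately show "welfare N \<mu> < welfare N \<mu>'"
    using diff ch strict by fastforce
qed

text \<open>As for a move to a hole, now with the utility gains of two moving pairs, which add up
  because \<open>potential_exchange\<close> has no cross term.\<close>

lemma exchange_improves:
  assumes valid: "valid_network N" and f: "f ` pairs N \<subseteq> channels N"
    and a: "a \<in> pairs N" and c: "c \<in> pairs N" and ne: "f a \<noteq> f c"
  defines "\<mu> \<equiv> allocation N f" and "\<mu>' \<equiv> allocation N (f(a := f c, c := f a))"
  assumes nw: "not_worse N (Pair a) \<mu> \<mu>'" "not_worse N (Pair c) \<mu> \<mu>'"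
    and ch: "U_channel N (f a) \<mu>' + U_channel N (f c) \<mu>' \<ge>
      U_channel N (f a) \<mu> + U_channel N (f c) \<mu>"
    and strict: "strictly_better N (Pair a) \<mu> \<mu>' \<or> strictly_better N (Pair c) \<mu> \<mu>' \<or>
      U_channel N (f a) \<mu>' + U_channel N (f c) \<mu>' > U_channel N (f a) \<mu> + U_channel N (f c) \<mu>"
  shows "is_matching N \<mu>' \<and> welfare N \<mu> < welfare N \<mu>'"
proof
  show "is_matching N \<mu>'"
    unfolding \<mu>'_def using f a c by (intro is_matching_allocation) auto
  have "(\<Sum>k\<in>channels N. U_channel N k \<mu>') - (\<Sum>k\<in>channels N. U_channel N k \<mu>)
      = (U_channel N (f a) \<mu>' + U_channel N (f c) \<mu>')
        - (U_channel N (f a) \<mu> + U_channel N (f c) \<mu>)"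
    using valid f a c ne
    by (intro sum_U_channel_diff) (auto simp: \<mu>_def \<mu>'_def pairs_on_allocation valid_network_def)
  moreover have "potential (pairs N) (standalone_rate N) (interference N) (f(a := f c, c := f a))
      - potential (pairs N) (standalone_rate N) (interference N) f
      = (\<phi> N a \<mu>' - \<phi> N a \<mu>) + (\<phi> N c \<mu>' - \<phi> N c \<mu>)"
    using potential_exchange[where W = "interference N", OF finite_pairs a c interference_commute ne]
      a c
    by (simp add: \<mu>_def \<mu>'_def \<phi>_allocation)
  ultimately have diff: "welfare N \<mu>' - welfare N \<mu>
      = \<xi>\<^sub>1 N * ((\<phi> N a \<mu>' - \<phi> N a \<mu>) + (\<phi> N c \<mu>' - \<phi> N c \<mu>))
        + ((U_channel N (f a) \<mu>' + U_channel N (f c) \<mu>')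
           - (U_channel N (f a) \<mu> + U_channel N (f c) \<mu>))"
    unfolding \<mu>_def \<mu>'_def welfare_allocation by (simp add: algebra_simps flip: distrib_left)
  have xi: "\<xi>\<^sub>1 N > 0"
    using valid by (simp add: valid_network_def)
  have dom: "a \<in> Domain \<mu>" "a \<in> Domain \<mu>'" "c \<in> Domain \<mu>" "c \<in> Domain \<mu>'"
    using a c by (simp_all add: \<mu>_def \<mu>'_def)
  have le: "\<phi> N a \<mu> \<le> \<phi> N a \<mu>'" "\<phi> N c \<mu> \<le> \<phi> N c \<mu>'"
    using nw U_pair_le_iff[OF valid dom(1,2)] U_pair_le_iff[OF valid dom(3,4)] by simp_all
  then have "0 \<le> \<xi>\<^sub>1 N * ((\<phi> N a \<mu>' - \<phi> N a \<mu>) + (\<phi> N c \<mu>' - \<phi> N c \<mu>))"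
    using xi by simp
  moreover have "0 < \<xi>\<^sub>1 N * ((\<phi> N a \<mu>' - \<phi> N a \<mu>) + (\<phi> N c \<mu>' - \<phi> N c \<mu>))"
    if "strictly_better N (Pair a) \<mu> \<mu>' \<or> strictly_better N (Pair c) \<mu> \<mu>'"
  proof -
    have "\<phi> N a \<mu> < \<phi> N a \<mu>' \<or> \<phi> N c \<mu> < \<phi> N c \<mu>'"
      using that U_pair_less_iff[OF valid dom(1,2)] U_pair_less_iff[OF valid dom(3,4)] by simp
    then have "0 < (\<phi> N a \<mu>' - \<phi> N a \<mu>) + (\<phi> N c \<mu>' - \<phi> N c \<mu>)"
      using le by linarith
    then show ?thesis
      using xi by simp
  qed
  ultimately show "welfare N \<mu> < welfare N \<mu>'"
    using diff ch strict by fastforce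
qed

text \<open>Case analysis on which player is a hole reduces every approved swap to an exchange or to
  a single move.\<close>

lemma approved_swap_improves:
  assumes valid: "valid_network N" and "is_matching N \<mu>" and "approved_swap N \<mu> \<mu>'"
  shows "is_matching N \<mu>' \<and> welfare N \<mu> < welfare N \<mu>'"
proof -
  obtain f where \<mu>: "\<mu> = allocation N f" and f: "f ` pairs N \<subseteq> channels N"
    using assms(2) by (rule is_matchingE)
  obtain s m t n where st: "s \<noteq> Hole \<or> t \<noteq> Hole"
    and matched: "matched_with N \<mu> s m" "matched_with N \<mu> t n"
    and \<mu>': "\<mu>' = swap \<mu> s m t n"
    and nw: "not_worse N s \<mu> \<mu>'" "not_worse N t \<mu> \<mu>'"
    and ch: "U_channel N m \<mu>' + U_channel N n \<mu>' \<ge> U_channel N m \<mu> + U_channel N n \<mu>"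
    and strict: "strictly_better N s \<mu> \<mu>' \<or> strictly_better N t \<mu> \<mu>' \<or>
      U_channel N m \<mu>' + U_channel N n \<mu>' > U_channel N m \<mu> + U_channel N n \<mu>"
    using assms(3) unfolding approved_swap_def by blast
  \<comment> \<open>A swap within one channel changes nothing, so none of the inequalities could be
    strict.\<close>
  have mn: "m \<noteq> n"
  proof
    assume "m = n"
    then have "\<mu>' = \<mu>"
      using matched \<mu>' swap_same_channel by metis
    then show False
      using strict by (cases s; cases t) auto
  qed
  show ?thesis
  proof (cases s)
    case s: (Pair a)
    then have a: "a \<in> pairs N" "m = f a"
      using matched \<mu> by auto
    show ?thesis
    proof (cases t)
      case t: (Pair c)
      then have c: "c \<in> pairs N" "n = f c"
        using matched \<mu> by auto
      have "\<mu>' = allocation N (f(a := f c, c := f a))"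
        using \<mu>' swap_allocation_Pair[of a N c f] a c mn by (simp add: s t \<mu>)
      then show ?thesis
        using exchange_improves[OF valid f a(1) c(1)] nw ch strict mn a(2) c(2) s t \<mu> by simp
    next
      case t: Hole
      have "\<mu>' = allocation N (f(a := n))"
        using \<mu>' swap_allocation_Hole[of a N f n] a by (simp add: s t \<mu>)
      then show ?thesis
        using move_to_hole_improves[OF valid f a(1), of n] nw ch strict mn a(2) matched s t \<mu> by simp
    qed
  next
    case s: Hole
    then obtain c where t: "t = Pair c"
      using st by (cases t) auto
    then have c: "c \<in> pairs N" "n = f c"
      using matched \<mu> by auto
    \<comment> \<open>The mirror image of the previous case: \<open>swap_commute\<close> puts the
      moving pair first, and \<open>add.commute\<close> below does the same for the two
      channels.\<close>
    have "\<mu>' = allocation N (f(c := m))"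
      using \<mu>' swap_allocation_Hole[of c N f m] c swap_commute[of \<mu> s m t n] by (simp add: s t \<mu>)
    then show ?thesis
      using move_to_hole_improves[OF valid f c(1), of m] nw ch strict mn c(2) matched s t \<mu>
      by (simp add: add.commute)
  qed
qed

section \<open>Termination of the swap phase\<close>

lemma finite_matchings:
  assumes "finite (channels N)"
  shows "finite {\<mu>. is_matching N \<mu>}"
  by (rule finite_subset[of _ "Pow (pairs N \<times> channels N)"]) (use assms in \<open>auto simp: is_matching_def\<close>)

text \<open>Strictly increasing welfare forbids repetitions, so an infinite sequence would inject
  the naturals into the finite set of matchings.\<close>

lemma no_infinite_approved_swaps:
  assumes valid: "valid_network N" and "is_matching N (\<mu> 0)"
    and step: "\<And>i. approved_swap N (\<mu> i) (\<mu> (Suc i))"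
  shows False
proof -
  have matching: "is_matching N (\<mu> i)" for i
    by (induction i) (use assms approved_swap_improves in blast)+
  have "strict_mono (\<lambda>i. welfare N (\<mu> i))"
    unfolding strict_mono_Suc_iff using approved_swap_improves[OF valid matching step] by blast
  then have "inj \<mu>"
    by (metis injI strict_mono_eq)
  then have "infinite (range \<mu>)"
    by (simp add: finite_image_iff)
  moreover have "finite (range \<mu>)"
  proof (rule finite_subset)
    show "range \<mu> \<subseteq> {\<nu>. is_matching N \<nu>}"
      using matching by blast
    show "finite {\<nu>. is_matching N \<nu>}"
      using finite_matchings[of N] valid by (simp add: valid_network_def)
  qed
  ultimately show False
    by blast
qed

section \<open>The initialization ends after one round of proposals\<close>

lemma keep_all:
  assumes "channel_rankings N S" "C \<subseteq> pairs N \<times> channels N"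
  shows "keep N S C = C"
proof -
  \<comment> \<open>A ranking lists every pair exactly once, so its length is the quota and
    \<open>take\<close> cuts nothing off.\<close>
  have "take (quota N k) (filter (\<lambda>e. (e, k) \<in> C) (S k)) = filter (\<lambda>e. (e, k) \<in> C) (S k)"
    if "k \<in> channels N" for k
  proof -
    have "length (S k) = card (pairs N)"
      using assms(1) that distinct_card by (fastforce simp: channel_rankings_def)
    then have "length (filter (\<lambda>e. (e, k) \<in> C) (S k)) \<le> quota N k"
      using length_filter_le[of "\<lambda>e. (e, k) \<in> C" "S k"] by (simp add: quota_def pairs_def)
    then show ?thesis
      by simp
  qed
  then show ?thesis
    using assms by (auto simp: keep_def channel_rankings_def)
qed

text \<open>Before any rejection the filter in \<open>proposals\<close> keeps the whole ranking, so
  each pair proposes to its head, which exists because there is at least one channel.\<close>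

lemma first_proposals:
  assumes "channels N \<noteq> {}" "pair_rankings N R"
  obtains f where "proposals N R {} {} = allocation N f" "f ` pairs N \<subseteq> channels N"
proof
  have ne: "R d \<noteq> []" "set (R d) = channels N" if "d \<in> pairs N" for d
    using assms that by (auto simp: pair_rankings_def)
  have first: "(\<exists>ks. R d = k # ks) \<longleftrightarrow> k = hd (R d)" if "d \<in> pairs N" for d k
    using ne(1)[OF that] by (cases "R d") auto
  show "proposals N R {} {} = allocation N (\<lambda>d. hd (R d))"
    by (auto simp: proposals_def first)
  show "(\<lambda>d. hd (R d)) ` pairs N \<subseteq> channels N"
    using ne hd_in_set by fastforce
qed

section \<open>Runs of the algorithm\<close>

inductive_cases ProposingE: "alg_step N R S (Proposing A B) c"
inductive_cases SwappingE: "alg_step N R S (Swapping \<mu>) c"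

text \<open>As there is at least one pair, the empty acceptance set cannot trigger
  \<open>initialized\<close>. The forced round of proposals is accepted entirely, so the rejection
  set stays empty.\<close>

lemma first_round:
  assumes "valid_network N" "pair_rankings N R" "channel_rankings N S"
    and "alg_step N R S (Proposing {} {}) c"
  shows "\<exists>A. c = Proposing A {} \<and> is_matching N A"
proof -
  obtain f where f: "proposals N R {} {} = allocation N f" "f ` pairs N \<subseteq> channels N"
    using first_proposals assms(1,2) unfolding valid_network_def by metis
  have "\<not> pairs N \<subseteq> {}"
    using assms(1) by (simp add: valid_network_def pairs_def)
  moreover have "keep N S (allocation N f) = allocation N f"
    using assms(3) f(2) by (intro keep_all) auto
  ultimately have "c = Proposing (allocation N f) {}"
    using assms(4) f(1) by (auto elim!: ProposingE)
  then show ?thesis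
    using is_matching_allocation[OF f(2)] by blast
qed

lemma end_of_initialization:
  assumes "is_matching N A" "alg_step N R S (Proposing A B) c"
  shows "c = Swapping A"
proof -
  have "pairs N \<subseteq> Domain A"
    using assms(1) unfolding is_matching_def by blast
  with assms(2) show ?thesis
    by (auto elim: ProposingE)
qed

text \<open>An invariant of all runs. The start is listed separately because its empty acceptance
  set is not a matching.\<close>

lemma reachable_configs:
  assumes "valid_network N" "pair_rankings N R" "channel_rankings N S"
    and "(alg_step N R S)\<^sup>*\<^sup>* (Proposing {} {}) c"
  shows "c = Proposing {} {} \<or> (\<exists>A. is_matching N A \<and> (c = Proposing A {} \<or> c = Swapping A))"
  using assms(4)
proof induction
  case (step c c')
  then show ?case
    using first_round[OF assms(1-3)] end_of_initialization approved_swap_improves[OF assms(1)]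
    by (fastforce elim: SwappingE)
qed simp

theorem theorem1:
  fixes N :: "'k d2d_network"
    and R :: "nat \<Rightarrow> 'k list"
    and S :: "'k \<Rightarrow> nat list"
  assumes "valid_network N"
    and "pair_rankings N R"
    and "channel_rankings N S"
  shows "\<not> (\<exists>c :: nat \<Rightarrow> 'k config.
              c 0 = Proposing {} {} \<and> (\<forall>i. alg_step N R S (c i) (c (Suc i)))) \<and>
         (\<forall>c. (alg_step N R S)\<^sup>*\<^sup>* (Proposing {} {}) c \<and> \<not> (\<exists>c'. alg_step N R S c c') \<longrightarrow>
              (\<exists>\<mu>. c = Swapping \<mu> \<and> strongly_swap_stable N \<mu>))"
proof (intro conjI notI allI impI)
  assume "\<exists>c. c 0 = Proposing {} {} \<and> (\<forall>i. alg_step N R S (c i) (c (Suc i)))"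
  then obtain c where c0: "c 0 = Proposing {} {}"
    and step: "\<And>i. alg_step N R S (c i) (c (Suc i))"
    by blast
  obtain A where A: "c 1 = Proposing A {}" "is_matching N A"
    using first_round[OF assms] step[of 0] c0 by auto
  have c2: "c 2 = Swapping A"
    using end_of_initialization[OF A(2)] step[of 1] A(1) by (simp add: numeral_2_eq_2)
  \<comment> \<open>The offset 2 skips the round of proposals and the change to the swap phase; a
    swapping configuration only leads to another one.\<close>
  have "\<exists>\<mu>. c (i + 2) = Swapping \<mu>" for i
  proof (induction i)
    case (Suc i)
    then obtain \<mu> where "c (i + 2) = Swapping \<mu>" ..
    then show ?case
      using step[of "i + 2"] by (auto elim: SwappingE)
  qed (use c2 in \<open>simp add: numeral_2_eq_2\<close>)
  then obtain \<mu> where \<mu>: "\<And>i. c (i + 2) = Swapping (\<mu> i)"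
    by metis
  have "approved_swap N (\<mu> i) (\<mu> (Suc i))" for i
    using step[of "i + 2"] \<mu>[of i] \<mu>[of "Suc i"] by (auto elim: SwappingE)
  moreover have "is_matching N (\<mu> 0)"
    using \<mu>[of 0] c2 A(2) by (simp add: numeral_2_eq_2)
  ultimately show False
    using no_infinite_approved_swaps[OF assms(1)] by blast
next
  fix c
  assume c: "(alg_step N R S)\<^sup>*\<^sup>* (Proposing {} {}) c \<and> \<not> (\<exists>c'. alg_step N R S c c')"
  \<comment> \<open>The premises on \<open>Domain A\<close> in \<open>propose\<close> and
    \<open>initialized\<close> are complementary, so a configuration without successor must be in
    the swap phase.\<close>
  have "\<exists>c'. alg_step N R S (Proposing A B) c'" for A B
    using alg_step.propose alg_step.initialized by metis
  then obtain \<mu> where \<mu>: "c = Swapping \<mu>" "is_matching N \<mu>"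
    using reachable_configs[OF assms] c by metis
  then have "\<not> (\<exists>\<mu>'. approved_swap N \<mu> \<mu>')"
    using c alg_step.swap by metis
  then show "\<exists>\<mu>. c = Swapping \<mu> \<and> strongly_swap_stable N \<mu>"
    using \<mu> by (auto simp: strongly_swap_stable_def)
qed

end
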